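(* Let $N\ge 1$ and $T_C\ge 2$. Let $\bm{A},\bm{B}^{(1)},\bm{B}^{(2)}\in\mathbb{R}^{N\times N}$ and $\bm{h}\in\mathbb{R}^N$ be fixed (not depending on $\bm{z}$ or on the context), and for every context sequence $\bm{C}=(\bm{c}_1,\dots,\bm{c}_{T_C})\in(\mathbb{R}^N)^{T_C}$ and every $\bm{z}\in\mathbb{R}^N$ define the nearest-neighbor affine map $$f(\bm{z},\bm{C})=\bm{A}\bm{z}+\bm{B}^{(1)}\bm{c}_{\tau(\bm{z})}+\bm{B}^{(2)}\bm{c}_{\tau(\bm{z})+1}+\bm{h},$$ where $\tau(\bm{z})=\tau(\bm{z},\bm{C})$ is the index of the nearest context point. Suppose that (a) ($O(N)$-equivariance) $f(Q\bm{z},Q\bm{C})=Q\,f(\bm{z},\bm{C})$ for all $Q\in O(N)$, all $\bm{z}$ and all $\bm{C}$, where $Q\bm{C}=(Q\bm{c}_1,\dots,Q\bm{c}_{T_C})$; (b) (translation equivariance) $f(\bm{z}+\bm{v},\bm{C}+\bm{v})=f(\bm{z},\bm{C})+\bm{v}$ for all $\bm{v}\in\mathbb{R}^N$, all $\bm{z}$ and all $\bm{C}$, where $\bm{C}+\bm{v}=(\bm{c}_1+\bm{v},\dots,\bm{c}_{T_C}+\bm{v})$. Then there exist $\alpha,\beta\in\mathbb{R}$ such that for all $\bm{z}$ and all $\bm{C}$, $$f(\bm{z},\bm{C})=\alpha\,\bm{z}+\beta\,\bm{c}_{\tau(\bm{z})}+(1-\alpha-\beta)\,\bm{c}_{\t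au(\bm{z})+1}.$$
   Context: For a context sequence $\bm{C}=(\bm{c}_1,\dots,\bm{c}_{T_C})$ in $\mathbb{R}^N$ and $\bm{z}\in\mathbb{R}^N$, the nearest-neighbor index is $\tau(\bm{z})=\tau(\bm{z},\bm{C})=\operatorname{arg\,min}_{1\le s\le T_C-1}\|\bm{c}_s-\bm{z}\|_2$, with ties broken by choosing the smallest index; the range $s\le T_C-1$ ensures that the temporal successor $\bm{c}_{\tau(\bm{z})+1}$ exists. $O(N)$ is the group of real orthogonal $N\times N$ matrices. *)

theory Defs
  imports "HOL-Analysis.Analysis"
begin

text \<open>
  A context sequence of length \<open>T\<close> is a function \<open>C :: nat \<Rightarrow> real ^ 'n\<close> of which only
  the entries \<open>C 1, \<dots>, C T\<close> are ever used: for \<open>T \<ge> 2\<close> the index below lies in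
  \<open>{1..T - 1}\<close>, so it and its successor lie in \<open>{1..T}\<close>.
  \<open>LEAST\<close> implements the tie-breaking by the smallest index.
\<close>

definition nn_index :: "nat \<Rightarrow> real ^ 'n \<Rightarrow> (nat \<Rightarrow> real ^ 'n) \<Rightarrow> nat" where
  "nn_index T z C = (LEAST s. is_arg_min (\<lambda>s. norm (C s - z)) (\<lambda>s. s \<in> {1..T - 1}) s)"

lemma nn_index_is_arg_min:
  assumes "T \<ge> 2"
  shows "is_arg_min (\<lambda>s. norm (C s - z)) (\<lambda>s. s \<in> {1..T - 1}) (nn_index T z C)"
proof -
  have "finite {1..T - 1}" "{1..T - 1} \<noteq> {}"
    using assms by auto
  then have "\<exists>s. is_arg_min (\<lambda>s. norm (C s - z)) (\<lambda>s. s \<in> {1..T - 1}) s"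
    by (rule ex_is_arg_min_if_finite)
  then show ?thesis
    unfolding nn_index_def by (rule LeastI_ex)
qed

definition nn_affine_map ::
  "real ^ 'n ^ 'n \<Rightarrow> real ^ 'n ^ 'n \<Rightarrow> real ^ 'n ^ 'n \<Rightarrow> real ^ 'n \<Rightarrow> nat
    \<Rightarrow> real ^ 'n \<Rightarrow> (nat \<Rightarrow> real ^ 'n) \<Rightarrow> real ^ 'n" where
  "nn_affine_map A B1 B2 h T z C =
     A *v z + B1 *v C (nn_index T z C) + B2 *v C (nn_index T z C + 1) + h"

end

theory Submission
  imports Defs
begin

text \<open>
  Contexts of the form \<open>(u, w, \<dots>, w)\<close> have nearest index \<open>1\<close> whenever \<open>u\<close> is at least as close
  to \<open>z\<close> as \<open>w\<close> is, so there \<open>f\<close> is \<open>A z + B\<^sup>1 u + B\<^sup>2 w + h\<close>. Choosing \<open>(z, u, w)\<close> as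
  \<open>(0, 0, 0)\<close>, \<open>(0, 0, w)\<close> and \<open>(x, 0, -x)\<close> in the orthogonal equivariance gives \<open>h = 0\<close> (from
  \<open>Q = -1\<close>) and makes \<open>B\<^sup>2\<close> and \<open>A\<close> commute with \<open>O(N)\<close>; \<open>z = u = w\<close> in the
  translation equivariance gives \<open>A + B\<^sup>1 + B\<^sup>2 = 1\<close>. A matrix commuting with the reflection
  along \<open>a\<close> has \<open>a\<close> as an eigenvector, so commuting with all of \<open>O(N)\<close> makes it scalar.
\<close>

lemma nn_index_eq_1:
  assumes "T \<ge> 2" and "norm (u - z) \<le> norm (w - z)"
  shows "nn_index T z (\<lambda>s. if s = 1 then u else w) = 1"
  unfolding nn_index_def
proof (rule Least_equality)
  show "is_arg_min (\<lambda>s. norm ((if s = 1 then u else w) - z)) (\<lambda>s. s \<in> {1..T - 1}) 1"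
    using assms by (auto simp: is_arg_min_linorder)
\<comment> \<open>Ties are harmless: every minimizer lies in \<open>{1..T - 1}\<close>, so none is
  below \<open>1\<close>.\<close>
qed (simp add: is_arg_min_def)

lemma orthogonal_transformation_reflection:
  fixes a :: "'a :: real_inner"
  assumes "a \<noteq> 0"
  shows "orthogonal_transformation (\<lambda>x. x - (2 * (a \<bullet> x) / (a \<bullet> a)) *\<^sub>R a)"
  unfolding orthogonal_transformation_def
proof (intro conjI allI)
  show "linear (\<lambda>x. x - (2 * (a \<bullet> x) / (a \<bullet> a)) *\<^sub>R a)"
    by (rule linearI) (simp_all add: algebra_simps add_divide_distrib)
  show "(v - (2 * (a \<bullet> v) / (a \<bullet> a)) *\<^sub>R a) \<bullet> (w - (2 * (a \<bullet> w) / (a \<bullet> a)) *\<^sub>R a) = v \<bullet> w" for v w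
    using assms by (simp add: inner_diff inner_commute field_simps)
qed

text \<open>The reflection along \<open>a\<close> negates \<open>a\<close>, so commuting forces it
  to negate \<open>M *v a\<close> too; the vectors it negates form the line through
  \<open>a\<close>. The coefficient is the Rayleigh quotient.\<close>

lemma commutes_orthogonal_eigenvector:
  fixes M :: "real ^ 'n ^ 'n"
  assumes comm: "\<And>Q x. orthogonal_matrix Q \<Longrightarrow> M *v (Q *v x) = Q *v (M *v x)"
    and "a \<noteq> 0"
  shows "M *v a = ((a \<bullet> (M *v a)) / (a \<bullet> a)) *\<^sub>R a"
proof -
  let ?R = "\<lambda>x. x - (2 * (a \<bullet> x) / (a \<bullet> a)) *\<^sub>R a"
  have R: "orthogonal_transformation ?R"
    by (rule orthogonal_transformation_reflection) fact
  then have works: "matrix ?R *v x = ?R x" for x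
    by (simp add: orthogonal_transformation_linear)
  have "orthogonal_matrix (matrix ?R)"
    using R orthogonal_transformation_matrix by blast
  then have "M *v ?R a = ?R (M *v a)"
    using comm[of "matrix ?R" a] by (simp only: works)
  moreover have "?R a = - a"
    using \<open>a \<noteq> 0\<close> by (simp add: scaleR_2)
  ultimately have "2 *\<^sub>R (M *v a) = 2 *\<^sub>R (((a \<bullet> (M *v a)) / (a \<bullet> a)) *\<^sub>R a)"
    by (simp add: scaleR_2 linear_neg algebra_simps)
  then show ?thesis
    by (metis scaleR_left_imp_eq zero_neq_numeral)
qed

lemma commutes_orthogonal_imp_scalar:
  fixes M :: "real ^ 'n ^ 'n"
  assumes comm: "\<And>Q x. orthogonal_matrix Q \<Longrightarrow> M *v (Q *v x) = Q *v (M *v x)"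
  obtains c where "\<And>x. M *v x = c *\<^sub>R x"
proof -
  define l where "l a = (a \<bullet> (M *v a)) / (a \<bullet> a)" for a
  have eig: "M *v a = l a *\<^sub>R a" if "a \<noteq> 0" for a
    using commutes_orthogonal_eigenvector[of M, OF comm that] by (simp add: l_def)
  fix k :: 'n
  have l_axis: "l (axis i 1) = l (axis k 1)" for i
  proof (cases "i = k")
    case False
    \<comment> \<open>The sum of the two axis vectors is again an eigenvector; its coordinates
      \<open>i\<close> and \<open>k\<close> show that both eigenvalues equal
      \<open>l ?a\<close>.\<close>
    let ?a = "axis i 1 + axis k 1 :: real ^ 'n"
    have "?a $ i = 1"
      using False by (auto simp: axis_def)
    then have "?a \<noteq> 0"
      by (metis zero_index zero_neq_one)
    have "l (axis i 1) *\<^sub>R axis i 1 + l (axis k 1) *\<^sub>R axis k 1 = M *v ?a"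
      by (simp add: matrix_vector_right_distrib eig axis_eq_0_iff)
    also have "\<dots> = l ?a *\<^sub>R ?a"
      by (rule eig) fact
    finally have eq: "l (axis i 1) *\<^sub>R axis i 1 + l (axis k 1) *\<^sub>R axis k 1 = l ?a *\<^sub>R ?a" .
    from arg_cong[OF eq, of "\<lambda>v. v $ i"] arg_cong[OF eq, of "\<lambda>v. v $ k"] False
    show ?thesis
      by (simp add: axis_def)
  qed simp
  have "M *v x = l (axis k 1) *\<^sub>R x" for x
  proof -
    have "(*v) M = (\<lambda>x. l (axis k 1) *\<^sub>R x)"
    proof (rule linear_eq_stdbasis)
      show "M *v b = l (axis k 1) *\<^sub>R b" if "b \<in> Basis" for b
        using that eig[of b] l_axis by (auto simp: Basis_vec_def axis_eq_0_iff)
    qed (simp_all add: linear_scale_self)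
    then show ?thesis
      by metis
  qed
  then show ?thesis
    by (rule that)
qed

theorem theorem1:
  fixes A B1 B2 :: "real ^ 'n ^ 'n" and h :: "real ^ 'n" and T :: nat
    and f :: "real ^ 'n \<Rightarrow> (nat \<Rightarrow> real ^ 'n) \<Rightarrow> real ^ 'n"
  defines "f \<equiv> nn_affine_map A B1 B2 h T"
  assumes "T \<ge> 2"
    and "\<And>(Q :: real ^ 'n ^ 'n) z C. orthogonal_matrix Q \<Longrightarrow>
           f (Q *v z) (\<lambda>s. Q *v C s) = Q *v f z C"
    and "\<And>v z C. f (z + v) (\<lambda>s. C s + v) = f z C + v"
  shows "\<exists>\<alpha> \<beta> :: real. \<forall>z C.
           f z C = \<alpha> *\<^sub>R z + \<beta> *\<^sub>R C (nn_index T z C)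
                   + (1 - \<alpha> - \<beta>) *\<^sub>R C (nn_index T z C + 1)"
proof -
  let ?C = "\<lambda>u w s. if s = (1::nat) then u else w :: real ^ 'n"
  have f_eq: "f z (?C u w) = A *v z + B1 *v u + B2 *v w + h"
    if "norm (u - z) \<le> norm (w - z)" for z u w
    using nn_index_eq_1[OF \<open>T \<ge> 2\<close> that] by (simp add: f_def nn_affine_map_def)
  \<comment> \<open>\<open>Q\<close> preserves distances, so index \<open>1\<close> is still
    selected after applying \<open>Q\<close> and the index drops out of the equivariance.\<close>
  have equiv: "A *v (Q *v z) + B1 *v (Q *v u) + B2 *v (Q *v w) + h
      = Q *v (A *v z + B1 *v u + B2 *v w + h)"
    if Q: "orthogonal_matrix Q" and le: "norm (u - z) \<le> norm (w - z)" for Q z u w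
  proof -
    have "norm (Q *v x) = norm x" for x
      using Q orthogonal_transformation_matrix[of "(*v) Q"] by (simp add: orthogonal_transformation_norm)
    then have "norm (Q *v u - Q *v z) \<le> norm (Q *v w - Q *v z)"
      using le by (simp flip: matrix_vector_mult_diff_distrib)
    moreover have "f (Q *v z) (?C (Q *v u) (Q *v w)) = Q *v f z (?C u w)"
      using assms(3)[OF Q, of z "?C u w"] by (simp add: if_distrib)
    ultimately show ?thesis
      using le by (simp only: f_eq)
  qed
  have "orthogonal_transformation (uminus :: real ^ 'n \<Rightarrow> real ^ 'n)"
    by (simp add: orthogonal_transformation_def module_hom_uminus)
  then have "orthogonal_matrix (matrix uminus :: real ^ 'n ^ 'n)"
    and "matrix uminus *v h = - h"
    using orthogonal_transformation_matrix matrix_vector_mul orthogonal_transformation_linear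
    by (blast, metis)
  then have "h = - h"
    using equiv[of "matrix uminus" 0 0 0] by simp
  then have h: "h = 0"
    by (simp add: vec_eq_iff)
  have B2_comm: "B2 *v (Q *v x) = Q *v (B2 *v x)" if "orthogonal_matrix Q" for Q x
    using equiv[OF that, of 0 0 x] by (simp add: h)
  then obtain \<gamma> where \<gamma>: "\<And>x. B2 *v x = \<gamma> *\<^sub>R x"
    using commutes_orthogonal_imp_scalar by blast
  have "A *v (Q *v x) = Q *v (A *v x)" if "orthogonal_matrix Q" for Q x
  proof -
    \<comment> \<open>Seen from \<open>x\<close>, the point \<open>- x\<close> is twice as far as
      \<open>0\<close>. Taking \<open>u = 0\<close> kills the \<open>B1\<close> term, and the
      \<open>B2\<close> terms cancel because \<open>B2\<close> is already scalar.\<close>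
    have "norm (0 - x) \<le> norm (- x - x)"
      using norm_ge_zero[of x] norm_scaleR[of "-2" x] by (simp add: scaleR_2)
    from equiv[OF that this] show ?thesis
      by (simp add: h \<gamma> linear_neg algebra_simps)
  qed
  then obtain \<alpha> where \<alpha>: "\<And>x. A *v x = \<alpha> *\<^sub>R x"
    using commutes_orthogonal_imp_scalar by blast
  \<comment> \<open>Translate by \<open>x\<close> the configuration in which all points are
    \<open>0\<close>.\<close>
  have "A *v x + B1 *v x + B2 *v x = x" for x
    using assms(4)[of 0 x "?C 0 0"] f_eq[of 0 0 0] f_eq[of x x x] by (simp add: h)
  then have B1: "B1 *v x = (1 - \<alpha> - \<gamma>) *\<^sub>R x" for x
    by (simp add: \<alpha> \<gamma> algebra_simps)
  show ?thesis
    \<comment> \<open>With \<beta> the scalar of \<open>B1\<close>, the remaining coefficient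
      \<open>1 - \<alpha> - \<beta>\<close> is \<gamma>, the scalar of \<open>B2\<close>.\<close>
    by (rule exI[of _ \<alpha>], rule exI[of _ "1 - \<alpha> - \<gamma>"])
      (simp add: f_def nn_affine_map_def \<alpha> \<gamma> B1 h)
qed

end
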